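(* Let $D$ be a finite set and $\Gamma$ a set of relations over $D$ such that every polymorphism $f\in\mathrm{Pol}(\Gamma)$ is either a constant operation or a projection. Then the co-clone $\langle\Gamma\rangle$ is $\exists!$-covered.
   Context: Relations over $D$ are subsets of $D^n$; $\mathrm{Eq}_D=\{(d,d)\mid d\in D\}$. An operation $f\colon D^k\to D$ preserves an $n$-ary relation $R$ if for all $t_1,\dots,t_k\in R$ the tuple $(f(t_1[1],\dots,t_k[1]),\dots,f(t_1[n],\dots,t_k[n]))$ lies in $R$; $\mathrm{Pol}(\Gamma)$ is the set of operations on $D$ (of all finite arities) preserving every relation of $\Gamma$. A projection is an operation $(x_1,\dots,x_k)\mapsto x_i$. A pp-definition of an $n$-ary relation $R$ over $\Gamma$ is a formula $R(x_1,\dots,x_n)\equiv\exists y_1,\dots,y_m\colon R_1(\mathbf{x}_1)\wedge\dots\wedge R_k(\mathbf{x}_k)$ with $R_j\in\Gamma\cup\{\mathrm{Eq}_D\}$ and each $\mathbf{x}_j$ a tuple of variables among $x_1,\dots,x_n,y_1,\dots,y_m$; $\langle\Gamma\rangle$ is the set of pp-definable relations (a co-clone), and $\Delta$ is a base of a co-clone $C$ if $\langle\Delta\rangle=C$. A upp-definition is a pp-definition in which each $y_j$ is uniquely determined by $x_1,\dots,x_n$ (there is $h_j\colon D^n\to D$ such that every satisfying assignment of the conjunction gives $y_j$ the value $h_j$ of the values of $x_1,\dots,x_n$); $\langle\Delta\rangle_{\exists!}$ is the set of upp-definable relations over $\Delta$. A co-clone $C$ is $\exists!$-covered if $\langle\Delta\rangle_{\exists!}=C$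 for every base $\Delta$ of $C$. *)

theory Defs
  imports "HOL-Library.NList" "HOL-Library.FuncSet"
begin

text \<open>
  Throughout, \<open>nlists n D\<close> plays the role of \<open>D\<^sup>n\<close>. The arity of a relation or operation is
  recorded explicitly, so that empty relations of different arities are distinct objects.
  Relations and operations have positive arity.
\<close>

type_synonym 'a relation = "nat \<times> 'a list set"
type_synonym 'a operation = "nat \<times> ('a list \<Rightarrow> 'a)"

definition relations :: "'a set \<Rightarrow> 'a relation set" where
  "relations D = {(n, R). n \<ge> 1 \<and> R \<subseteq> nlists n D}"

definition operations :: "'a set \<Rightarrow> 'a operation set" where
  "operations D = {(k, f). k \<ge> 1 \<and> f \<in> nlists k D \<rightarrow>\<^sub>E D}"

definition Eq_rel :: "'a set \<Rightarrow> 'a relation" where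
  "Eq_rel D = (2, {[d, d] | d. d \<in> D})"

fun preserves :: "'a operation \<Rightarrow> 'a relation \<Rightarrow> bool" where
  "preserves (k, f) (n, R) \<longleftrightarrow>
     (\<forall>ts \<in> nlists k R. map (\<lambda>i. f (map (\<lambda>t. t ! i) ts)) [0..<n] \<in> R)"

definition Pol :: "'a set \<Rightarrow> 'a relation set \<Rightarrow> 'a operation set" where
  "Pol D \<Gamma> = {p \<in> operations D. \<forall>r \<in> \<Gamma>. preserves p r}"

fun is_projection :: "'a set \<Rightarrow> 'a operation \<Rightarrow> bool" where
  "is_projection D (k, f) \<longleftrightarrow> (\<exists>i<k. \<forall>xs \<in> nlists k D. f xs = xs ! i)"

fun is_constant :: "'a set \<Rightarrow> 'a operation \<Rightarrow> bool" where
  "is_constant D (k, f) \<longleftrightarrow> (\<exists>c \<in> D. \<forall>xs \<in> nlists k D. f xs = c)"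

text \<open>
  A conjunction of atoms is a list of pairs of a relation and its tuple of variables. With \<open>n\<close>
  free and \<open>m\<close> quantified variables, the indices \<open>0, \<dots>, n - 1\<close> stand for the \<open>x\<^sub>i\<close> and
  \<open>n, \<dots>, n + m - 1\<close> for the \<open>y\<^sub>j\<close>; an assignment is the list \<open>xs @ ys\<close> of their values.
\<close>

type_synonym 'a conjunction = "('a relation \<times> nat list) list"

definition conjunction_over :: "'a set \<Rightarrow> 'a relation set \<Rightarrow> nat \<Rightarrow> 'a conjunction \<Rightarrow> bool" where
  "conjunction_over D \<Gamma> N \<phi> \<longleftrightarrow>
     (\<forall>(r, vs) \<in> set \<phi>. r \<in> \<Gamma> \<union> {Eq_rel D} \<and> vs \<in> nlists (fst r) {..<N})"

definition satisfies :: "'a list \<Rightarrow> 'a conjunction \<Rightarrow> bool" where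
  "satisfies a \<phi> \<longleftrightarrow> (\<forall>(r, vs) \<in> set \<phi>. map (\<lambda>v. a ! v) vs \<in> snd r)"

definition pp_definition ::
    "'a set \<Rightarrow> 'a relation set \<Rightarrow> nat \<Rightarrow> nat \<Rightarrow> 'a conjunction \<Rightarrow> 'a list set \<Rightarrow> bool" where
  "pp_definition D \<Gamma> n m \<phi> R \<longleftrightarrow>
     conjunction_over D \<Gamma> (n + m) \<phi> \<and>
     R = {xs \<in> nlists n D. \<exists>ys \<in> nlists m D. satisfies (xs @ ys) \<phi>}"

definition upp_definition ::
    "'a set \<Rightarrow> 'a relation set \<Rightarrow> nat \<Rightarrow> nat \<Rightarrow> 'a conjunction \<Rightarrow> 'a list set \<Rightarrow> bool" where
  "upp_definition D \<Gamma> n m \<phi> R \<longleftrightarrow>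
     pp_definition D \<Gamma> n m \<phi> R \<and>
     (\<forall>j<m. \<exists>h \<in> nlists n D \<rightarrow> D. \<forall>xs \<in> nlists n D. \<forall>ys \<in> nlists m D.
        satisfies (xs @ ys) \<phi> \<longrightarrow> ys ! j = h xs)"

definition pp_closure :: "'a set \<Rightarrow> 'a relation set \<Rightarrow> 'a relation set" where
  "pp_closure D \<Gamma> = {(n, R). n \<ge> 1 \<and> (\<exists>m \<phi>. pp_definition D \<Gamma> n m \<phi> R)}"

definition upp_closure :: "'a set \<Rightarrow> 'a relation set \<Rightarrow> 'a relation set" where
  "upp_closure D \<Gamma> = {(n, R). n \<ge> 1 \<and> (\<exists>m \<phi>. upp_definition D \<Gamma> n m \<phi> R)}"

definition is_base :: "'a set \<Rightarrow> 'a relation set \<Rightarrow> 'a relation set \<Rightarrow> bool" where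
  "is_base D \<Delta> C \<longleftrightarrow> \<Delta> \<subseteq> relations D \<and> pp_closure D \<Delta> = C"

definition uniquely_covered :: "'a set \<Rightarrow> 'a relation set \<Rightarrow> bool" where
  "uniquely_covered D C \<longleftrightarrow> (\<forall>\<Delta>. is_base D \<Delta> C \<longrightarrow> upp_closure D \<Delta> = C)"

end

theory Submission
  imports Defs
begin

text \<open>
  Let \<open>\<Delta>\<close> be a base and \<open>R\<close> a nonempty relation of the co-clone; every polymorphism of \<open>\<Delta>\<close> is
  constant or a projection. Let \<open>U\<close> be the set of values of constant polymorphisms and let
  \<open>t\<^sub>1, \<dots>, t\<^sub>k\<close> be the tuples of \<open>R\<close> that are not of the form \<open>(c, \<dots>, c)\<close> with \<open>c \<in> U\<close>. Take
  quantified variables \<open>y\<^sub>s\<close> for \<open>s \<in> D\<^sup>k\<close>, constrain them to form the value table of a \<open>k\<close>-ary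
  polymorphism, and identify \<open>x\<^sub>i\<close> with \<open>y\<^sub>s\<close> for \<open>s\<close> the \<open>i\<close>-th column of \<open>t\<^sub>1, \<dots>, t\<^sub>k\<close>. The
  \<open>j\<close>-th projection yields \<open>x = t\<^sub>j\<close> and the constant \<open>c \<in> U\<close> yields \<open>x = (c, \<dots>, c)\<close>. These
  are exactly the tuples of \<open>R\<close>, and by the choice of the \<open>t\<^sub>j\<close> they are pairwise distinct, so \<open>x\<close>
  determines the table. For empty \<open>R\<close> any pp-definition is vacuously a upp-definition.
\<close>

(* As simp rules these loop when membership in nlists is unfolded. *)
declare nlistsE_length [simp del] nlistsE_set [simp del]

section \<open>Tuples and their columns\<close>

lemma in_nlists_iff: "xs \<in> nlists n A \<longleftrightarrow> length xs = n \<and> set xs \<subseteq> A"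
  by (auto simp: nlists_def)

lemma finite_nlists: "finite A \<Longrightarrow> finite (nlists n A)"
  by (rule finite_subset[OF _ finite_lists_length_eq[of A n]]) (auto simp: nlists_def)

lemma column_in_nlists:
  assumes "ts \<in> nlists k R" and "R \<subseteq> nlists n D" and "i < n"
  shows "map (\<lambda>t. t ! i) ts \<in> nlists k D"
proof -
  have "t ! i \<in> D" if "t \<in> set ts" for t
  proof -
    have "t \<in> nlists n D" using that assms nlistsE_set by blast
    then show ?thesis using \<open>i < n\<close> by (rule nlistsE_nth_in)
  qed
  then show ?thesis using assms(1) by (auto simp: in_nlists_iff)
qed

lemma relation_subset_nlists:
  assumes "r \<in> \<Delta>" and "\<Delta> \<subseteq> relations D"
  shows "snd r \<subseteq> nlists (fst r) D"
proof -
  have "r \<in> relations D" using assms by blast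
  then show ?thesis by (auto simp: relations_def)
qed

section \<open>Polymorphisms and pp-definable relations\<close>

lemma preserves_Eq_rel:
  assumes "(k, f) \<in> operations D"
  shows "preserves (k, f) (Eq_rel D)"
proof -
  have "[f (map (\<lambda>t. t ! 0) ts), f (map (\<lambda>t. t ! 1) ts)] \<in> {[d, d] | d. d \<in> D}"
    if ts: "ts \<in> nlists k {[d, d] | d. d \<in> D}" for ts
  proof -
    \<comment> \<open>The two columns are the same list of arguments, so \<open>f\<close> takes the
      same value on both.\<close>
    have "map (\<lambda>t. t ! 0) ts = map (\<lambda>t. t ! 1) ts"
      using ts by (auto simp: in_nlists_iff)
    moreover have "map (\<lambda>t. t ! 1) ts \<in> nlists k D"
      by (rule column_in_nlists[OF ts, of 2]) (auto simp: in_nlists_iff)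
    ultimately show ?thesis
      using assms by (auto simp: operations_def simp del: map_eq_conv)
  qed
  then show ?thesis by (simp add: Eq_rel_def numeral_2_eq_2)
qed

text \<open>Each tuple of \<open>R\<close> is extended by witnesses \<open>w t\<close> for the
  quantified variables. Applying \<open>f\<close> to these witnesses coordinatewise gives witnesses
  for the image tuple.\<close>

lemma preserves_pp_definable:
  assumes op: "(k, f) \<in> operations D" and pres: "\<forall>r \<in> \<Delta>. preserves (k, f) r"
    and pp: "pp_definition D \<Delta> n m \<phi> R"
  shows "preserves (k, f) (n, R)"
proof -
  have R: "R = {xs \<in> nlists n D. \<exists>ys \<in> nlists m D. satisfies (xs @ ys) \<phi>}"
    and over: "conjunction_over D \<Delta> (n + m) \<phi>"
    using pp by (auto simp: pp_definition_def)
  have "map (\<lambda>i. f (map (\<lambda>t. t ! i) ts)) [0..<n] \<in> R" if ts: "ts \<in> nlists k R" for ts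
  proof -
    have "\<forall>t \<in> R. \<exists>ys. ys \<in> nlists m D \<and> satisfies (t @ ys) \<phi>"
      unfolding R by blast
    then obtain w where w: "\<And>t. t \<in> R \<Longrightarrow> w t \<in> nlists m D \<and> satisfies (t @ w t) \<phi>"
      by metis
    have tsR: "t \<in> R" if "t \<in> set ts" for t
      using that ts by (auto simp: in_nlists_iff)
    have len: "length t = n" if "t \<in> set ts" for t
      using tsR[OF that] unfolding R by (auto simp: in_nlists_iff)
    have tsk: "length ts = k" using ts by (auto simp: in_nlists_iff)
    let ?xs = "map (\<lambda>i. f (map (\<lambda>t. t ! i) ts)) [0..<n]"
    let ?ys = "map (\<lambda>i. f (map (\<lambda>t. w t ! i) ts)) [0..<m]"
    have fD: "f s \<in> D" if "s \<in> nlists k D" for s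
      using op that by (auto simp: operations_def)
    have "R \<subseteq> nlists n D" unfolding R by blast
    then have xs: "?xs \<in> nlists n D"
      using fD column_in_nlists[OF ts, of n D] by (auto simp: in_nlists_iff[of _ n])
    have "map (\<lambda>t. w t ! i) ts \<in> nlists k D" if "i < m" for i
    proof -
      have "map w ts \<in> nlists k (nlists m D)"
        using w tsR tsk by (auto simp: in_nlists_iff[of _ k])
      from column_in_nlists[OF this subset_refl that] show ?thesis by (simp add: o_def)
    qed
    then have ys: "?ys \<in> nlists m D"
      using fD by (auto simp: in_nlists_iff[of _ m])
    \<comment> \<open>Free and quantified positions can now be treated alike: \<open>f\<close> acts
      coordinatewise on the extended tuples.\<close>
    have nth: "(?xs @ ?ys) ! v = f (map (\<lambda>t. (t @ w t) ! v) ts)" if "v < n + m" for v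
    proof -
      have "map (\<lambda>t. (t @ w t) ! v) ts = map (\<lambda>t. if v < n then t ! v else w t ! (v - n)) ts"
        using len by (auto simp: nth_append)
      then have "f (map (\<lambda>t. (t @ w t) ! v) ts) = f (map (\<lambda>t. if v < n then t ! v else w t ! (v - n)) ts)"
        by (rule arg_cong)
      then show ?thesis using that by (auto simp: nth_append[of "map _ _"])
    qed
    have "map ((!) (?xs @ ?ys)) vs \<in> snd r" if rvs: "(r, vs) \<in> set \<phi>" for r vs
    proof -
      have r: "r \<in> \<Delta> \<union> {Eq_rel D}" and vs: "vs \<in> nlists (fst r) {..<n + m}"
        using over rvs by (auto simp: conjunction_over_def)
      have p: "preserves (k, f) (fst r, snd r)"
        using r pres preserves_Eq_rel[OF op] by auto
      \<comment> \<open>Each extended tuple is read off at the variables of the atom, which gives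
        \<open>k\<close> tuples of \<open>r\<close> to which preservation of \<open>r\<close>
        applies.\<close>
      let ?us = "map (\<lambda>t. map ((!) (t @ w t)) vs) ts"
      have "?us \<in> nlists k (snd r)"
        using rvs w tsR tsk by (fastforce simp: in_nlists_iff satisfies_def)
      then have "map (\<lambda>i. f (map (\<lambda>t. t ! i) ?us)) [0..<fst r] \<in> snd r"
        using p by (simp only: preserves.simps)
      also have "map (\<lambda>i. f (map (\<lambda>t. t ! i) ?us)) [0..<fst r] = map ((!) (?xs @ ?ys)) vs"
        using vs nth by (intro nth_equalityI) (auto simp: in_nlists_iff o_def subset_iff)
      finally show ?thesis .
    qed
    then have "satisfies (?xs @ ?ys) \<phi>"
      by (auto simp: satisfies_def)
    with xs ys show ?thesis unfolding R by blast
  qed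
  then show ?thesis by simp
qed

lemma subset_pp_closure:
  assumes "\<Gamma> \<subseteq> relations D"
  shows "\<Gamma> \<subseteq> pp_closure D \<Gamma>"
proof
  fix r assume r: "r \<in> \<Gamma>"
  obtain n R where [simp]: "r = (n, R)" by force
  have n: "n \<ge> 1" "R \<subseteq> nlists n D" using r assms by (auto simp: relations_def)
  have "map ((!) xs) [0..<n] = xs" if "xs \<in> nlists n D" for xs
    using that by (auto simp: in_nlists_iff map_nth)
  then have "pp_definition D \<Gamma> n 0 [(r, [0..<n])] R"
    using n r by (auto simp: pp_definition_def conjunction_over_def satisfies_def intro: nlistsI)
  then show "r \<in> pp_closure D \<Gamma>"
    using n by (auto simp: pp_closure_def)
qed

lemma upp_closure_subset_pp_closure: "upp_closure D \<Delta> \<subseteq> pp_closure D \<Delta>"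
  by (auto simp: upp_closure_def pp_closure_def upp_definition_def)

text \<open>This transfers the hypothesis on the polymorphisms of \<Gamma> to every base of the same
  co-clone.\<close>

lemma Pol_subset_if_subset_pp_closure:
  assumes "\<Gamma> \<subseteq> pp_closure D \<Delta>"
  shows "Pol D \<Delta> \<subseteq> Pol D \<Gamma>"
proof
  fix p assume p: "p \<in> Pol D \<Delta>"
  obtain k f where [simp]: "p = (k, f)" by force
  have "preserves p r" if r: "r \<in> \<Gamma>" for r
  proof -
    obtain n R where [simp]: "r = (n, R)" by force
    obtain m \<phi> where "pp_definition D \<Delta> n m \<phi> R"
      using assms r by (auto simp: pp_closure_def)
    then have "preserves (k, f) (n, R)"
      using p by (intro preserves_pp_definable[of k f D \<Delta>]) (auto simp: Pol_def simp del: preserves.simps)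
    then show ?thesis by (simp only: \<open>p = (k, f)\<close> \<open>r = (n, R)\<close>)
  qed
  then show "p \<in> Pol D \<Gamma>" using p by (simp add: Pol_def)
qed

section \<open>Finite conjunctions and the empty relation\<close>

text \<open>
  \<open>\<Delta>\<close> may be infinite. Over a finite domain one violated atom per bad assignment suffices.
\<close>

lemma finite_equivalent_conjunction:
  assumes "finite D"
  obtains \<phi> where "set \<phi> \<subseteq> \<Phi>"
    and "\<And>a. a \<in> nlists N D \<Longrightarrow> satisfies a \<phi> \<longleftrightarrow> (\<forall>(r, vs) \<in> \<Phi>. map ((!) a) vs \<in> snd r)"
proof -
  define sat where "sat = (\<lambda>a p. map ((!) a) (snd p) \<in> snd (fst (p :: 'a relation \<times> nat list)))"
  have sat_iff: "(\<forall>(r, vs) \<in> A. map ((!) a) vs \<in> snd r) \<longleftrightarrow> (\<forall>p \<in> A. sat a p)" for A a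
    by (simp add: sat_def case_prod_beta)
  define B where "B = {a \<in> nlists N D. \<exists>p \<in> \<Phi>. \<not> sat a p}"
  have "\<forall>a \<in> B. \<exists>p. p \<in> \<Phi> \<and> \<not> sat a p" unfolding B_def by blast
  then obtain g where g: "\<forall>a \<in> B. g a \<in> \<Phi> \<and> \<not> sat a (g a)"
    by (rule bchoice[THEN exE])
  have "finite B"
    using finite_nlists[OF assms, of N] unfolding B_def by (rule finite_subset[rotated]) blast
  then obtain \<phi> where \<phi>: "set \<phi> = g ` B" by (metis finite_imageI finite_list)
  show thesis
  proof
    show "set \<phi> \<subseteq> \<Phi>" unfolding \<phi> using g by (simp add: image_subset_iff)
  next
    fix a assume "a \<in> nlists N D"
    then have "(\<forall>p \<in> g ` B. sat a p) \<longleftrightarrow> (\<forall>p \<in> \<Phi>. sat a p)"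
      using g unfolding B_def by blast
    then show "satisfies a \<phi> \<longleftrightarrow> (\<forall>(r, vs) \<in> \<Phi>. map ((!) a) vs \<in> snd r)"
      unfolding satisfies_def sat_iff \<phi> .
  qed
qed

lemma upp_definition_if_empty:
  assumes "pp_definition D \<Delta> n m \<phi> {}" and "n \<ge> 1"
  shows "upp_definition D \<Delta> n m \<phi> {}"
proof -
  \<comment> \<open>Some \<open>h\<close> must exist even though nothing constrains it. For empty
    \<open>D\<close> it does because \<open>n\<close> is positive, so that there are no
    arguments.\<close>
  have "nlists n D \<rightarrow> D \<noteq> {}"
    using \<open>n \<ge> 1\<close> by (cases "D = {}") (auto simp: in_nlists_iff Pi_eq_empty)
  then show ?thesis
    using assms by (auto simp: upp_definition_def pp_definition_def)
qed

section \<open>Compatible functions and diagonal values\<close>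

text \<open>
  For \<open>k \<ge> 1\<close> this says that \<open>f\<close> preserves all of \<open>\<Delta>\<close>. Leaving out the empty relations makes the
  notion right for \<open>k = 0\<close> as well, where it says that \<open>f []\<close> is a diagonal value. This case occurs
  when \<open>R\<close> consists only of tuples \<open>(c, \<dots>, c)\<close> with \<open>c \<in> U\<close>.
\<close>

definition nonempty_compatible :: "'a relation set \<Rightarrow> nat \<Rightarrow> ('a list \<Rightarrow> 'a) \<Rightarrow> bool" where
  "nonempty_compatible \<Delta> k f \<longleftrightarrow>
     (\<forall>r \<in> \<Delta>. snd r \<noteq> {} \<longrightarrow>
       (\<forall>ts \<in> nlists k (snd r). map (\<lambda>i. f (map (\<lambda>t. t ! i) ts)) [0..<fst r] \<in> snd r))"

text \<open>This is the set of values of constant polymorphisms of \<Delta>: a constant operation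
  preserves every empty relation, and a nonempty one exactly if it contains the constant
  tuple.\<close>

definition diagonal_values :: "'a set \<Rightarrow> 'a relation set \<Rightarrow> 'a set" where
  "diagonal_values D \<Delta> = {c \<in> D. \<forall>r \<in> \<Delta>. snd r \<noteq> {} \<longrightarrow> replicate (fst r) c \<in> snd r}"

lemma compatible_classification:
  assumes \<Delta>: "\<Delta> \<subseteq> relations D"
    and pol: "\<And>p. p \<in> Pol D \<Delta> \<Longrightarrow> is_constant D p \<or> is_projection D p"
    and f: "f \<in> nlists k D \<rightarrow> D" and comp: "nonempty_compatible \<Delta> k f"
  shows "(\<exists>c \<in> diagonal_values D \<Delta>. \<forall>s \<in> nlists k D. f s = c) \<or>
         (\<exists>i<k. \<forall>s \<in> nlists k D. f s = s ! i)"
proof -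
  have diag: "c \<in> diagonal_values D \<Delta>" if c: "c \<in> D" "\<forall>s \<in> nlists k D. f s = c" for c
  proof -
    have "replicate (fst r) c \<in> snd r" if r: "r \<in> \<Delta>" and ne: "snd r \<noteq> {}" for r
    proof -
      from ne obtain t where t: "t \<in> snd r" by blast
      \<comment> \<open>Every column of \<open>k\<close> copies of one tuple is an argument in
        \<open>nlists k D\<close>, where \<open>f\<close> is \<open>c\<close>. For
        \<open>k = 0\<close> the list is empty and the argument still works.\<close>
      let ?ts = "replicate k t"
      have ts: "?ts \<in> nlists k (snd r)" using t by (auto simp: in_nlists_iff)
      have sub: "snd r \<subseteq> nlists (fst r) D" using r \<Delta> by (rule relation_subset_nlists)
      have "map (\<lambda>i. f (map (\<lambda>t. t ! i) ?ts)) [0..<fst r] \<in> snd r"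
        using comp r ne ts unfolding nonempty_compatible_def by blast
      also have "map (\<lambda>i. f (map (\<lambda>t. t ! i) ?ts)) [0..<fst r] = map (\<lambda>i. c) [0..<fst r]"
        using column_in_nlists[OF ts sub] c by auto
      also have "\<dots> = replicate (fst r) c" by (simp add: map_replicate_const)
      finally show ?thesis .
    qed
    then show ?thesis using c by (auto simp: diagonal_values_def)
  qed
  show ?thesis
  proof (cases "k = 0")
    case True
    \<comment> \<open>Operations have positive arity, so \<open>pol\<close> says nothing here; but a
      function of no arguments is constant.\<close>
    then have "nlists k D = {[]}" by (auto simp: in_nlists_iff)
    then show ?thesis using f diag by auto
  next
    case False
    \<comment> \<open>Operations are extensional, hence the restriction.\<close>
    let ?f = "restrict f (nlists k D)"
    have "preserves (k, ?f) r" if r: "r \<in> \<Delta>" for r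
    proof -
      have "map (\<lambda>i. ?f (map (\<lambda>t. t ! i) ts)) [0..<fst r] \<in> snd r" if ts: "ts \<in> nlists k (snd r)" for ts
      proof -
        have "snd r \<noteq> {}" using ts False by (auto simp: in_nlists_iff)
        then have "map (\<lambda>i. f (map (\<lambda>t. t ! i) ts)) [0..<fst r] \<in> snd r"
          using comp r ts unfolding nonempty_compatible_def by blast
        moreover have "snd r \<subseteq> nlists (fst r) D" using r \<Delta> by (rule relation_subset_nlists)
        then have "map (\<lambda>i. ?f (map (\<lambda>t. t ! i) ts)) [0..<fst r] =
            map (\<lambda>i. f (map (\<lambda>t. t ! i) ts)) [0..<fst r]"
          using column_in_nlists[OF ts] by auto
        ultimately show ?thesis by (simp only:)
      qed
      then show ?thesis by (metis preserves.simps surjective_pairing)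
    qed
    moreover have "(k, ?f) \<in> operations D"
      using False f by (auto simp: operations_def)
    ultimately have "is_constant D (k, ?f) \<or> is_projection D (k, ?f)"
      using pol[of "(k, ?f)"] unfolding Pol_def by blast
    then show ?thesis using diag by auto
  qed
qed

text \<open>A tuple of \<open>R\<close> comes with a satisfying assignment, so every relation
  occurring in \<phi> is nonempty. Hence the assignment that gives all variables, quantified ones
  included, the value \<open>c\<close> satisfies \<phi>.\<close>

lemma replicate_diagonal_in_pp_definable:
  assumes \<Delta>: "\<Delta> \<subseteq> relations D" and pp: "pp_definition D \<Delta> n m \<phi> R"
    and "R \<noteq> {}" and c: "c \<in> diagonal_values D \<Delta>"
  shows "replicate n c \<in> R"
proof -
  have R: "R = {xs \<in> nlists n D. \<exists>ys \<in> nlists m D. satisfies (xs @ ys) \<phi>}"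
    and over: "conjunction_over D \<Delta> (n + m) \<phi>"
    using pp by (auto simp: pp_definition_def)
  have cD: "c \<in> D" using c by (simp add: diagonal_values_def)
  from \<open>R \<noteq> {}\<close> obtain a where a: "satisfies a \<phi>" unfolding R by blast
  have "map ((!) (replicate (n + m) c)) vs \<in> snd r" if rvs: "(r, vs) \<in> set \<phi>" for r vs
  proof -
    have r: "r \<in> \<Delta> \<union> {Eq_rel D}" and vs: "vs \<in> nlists (fst r) {..<n + m}"
      using over rvs by (auto simp: conjunction_over_def)
    have "map ((!) (replicate (n + m) c)) vs = replicate (fst r) c"
      using vs by (intro nth_equalityI) (auto simp: in_nlists_iff subset_iff)
    moreover have "snd r \<noteq> {}" using a rvs by (auto simp: satisfies_def)
    then have "replicate (fst r) c \<in> snd r"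
      using r c cD by (auto simp: diagonal_values_def Eq_rel_def numeral_2_eq_2)
    ultimately show ?thesis by simp
  qed
  then have "satisfies (replicate n c @ replicate m c) \<phi>"
    by (auto simp: satisfies_def simp flip: replicate_add)
  then show ?thesis unfolding R using cD by (auto simp: in_nlists_iff intro!: bexI[of _ "replicate m c"])
qed

section \<open>The indicator construction\<close>

text \<open>Such conjunctions are known as indicator problems. A \<open>k\<close>-ary function is
  stored as the list \<open>ys\<close> of its values, with \<open>g\<close> numbering the arguments;
  compatibility then becomes a conjunction of atoms of \<Delta> on the entries of that list.\<close>

lemma indicator_conjunction:
  assumes "finite D" and \<Delta>: "\<Delta> \<subseteq> relations D" and T: "T \<in> nlists k (nlists n D)"
  obtains m \<phi> g where "conjunction_over D \<Delta> (n + m) \<phi>"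
    and "bij_betw g (nlists k D) {..<m}"
    and "\<And>xs ys. xs \<in> nlists n D \<Longrightarrow> ys \<in> nlists m D \<Longrightarrow>
      satisfies (xs @ ys) \<phi> \<longleftrightarrow>
        nonempty_compatible \<Delta> k (\<lambda>s. ys ! g s) \<and>
        xs = map (\<lambda>i. ys ! g (map (\<lambda>t. t ! i) T)) [0..<n]"
proof -
  define m where "m = card (nlists k D)"
  obtain g where g: "bij_betw g (nlists k D) {..<m}"
    using ex_bij_betw_finite_nat[OF finite_nlists[OF \<open>finite D\<close>]] unfolding m_def
    by (auto simp: atLeast0LessThan)
  have gm: "g s < m" if "s \<in> nlists k D" for s
    using g that by (auto simp: bij_betw_def)
  \<comment> \<open>These atoms spell out \<open>nonempty_compatible\<close>. The shift by
    \<open>n\<close> skips the indices of the free variables.\<close>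
  define \<Phi>1 where "\<Phi>1 = {(r, map (\<lambda>i. n + g (map (\<lambda>t. t ! i) ts)) [0..<fst r]) | r ts.
      r \<in> \<Delta> \<and> snd r \<noteq> {} \<and> ts \<in> nlists k (snd r)}"
  \<comment> \<open>The free variables have indices of their own, so they are tied to the table by
    equality atoms.\<close>
  define \<Phi>2 where "\<Phi>2 = {(Eq_rel D, [i, n + g (map (\<lambda>t. t ! i) T)]) | i. i < n}"
  obtain \<phi> where \<phi>: "set \<phi> \<subseteq> \<Phi>1 \<union> \<Phi>2"
    and sat: "\<And>a. a \<in> nlists (n + m) D \<Longrightarrow>
      satisfies a \<phi> \<longleftrightarrow> (\<forall>(r, vs) \<in> \<Phi>1 \<union> \<Phi>2. map ((!) a) vs \<in> snd r)"
    using finite_equivalent_conjunction[OF \<open>finite D\<close>] by metis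
  have colT: "map (\<lambda>t. t ! i) T \<in> nlists k D" if "i < n" for i
    using column_in_nlists[OF T subset_refl that] .
  show thesis
  proof
    have "r \<in> \<Delta> \<union> {Eq_rel D} \<and> vs \<in> nlists (fst r) {..<n + m}" if "(r, vs) \<in> \<Phi>1 \<union> \<Phi>2" for r vs
      using that
    proof
      assume "(r, vs) \<in> \<Phi>1"
      then obtain ts where r: "r \<in> \<Delta>" and ts: "ts \<in> nlists k (snd r)"
        and vs: "vs = map (\<lambda>i. n + g (map (\<lambda>t. t ! i) ts)) [0..<fst r]"
        unfolding \<Phi>1_def by blast
      have "snd r \<subseteq> nlists (fst r) D" using r \<Delta> by (rule relation_subset_nlists)
      then show ?thesis
        using r gm column_in_nlists[OF ts] by (auto simp: vs in_nlists_iff[of _ "fst r"])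
    next
      assume "(r, vs) \<in> \<Phi>2"
      then show ?thesis using gm colT by (auto simp: \<Phi>2_def Eq_rel_def in_nlists_iff[of _ 2])
    qed
    then show "conjunction_over D \<Delta> (n + m) \<phi>"
      using \<phi> by (fastforce simp: conjunction_over_def)
    show "bij_betw g (nlists k D) {..<m}" by (rule g)
  next
    fix xs ys assume xs: "xs \<in> nlists n D" and ys: "ys \<in> nlists m D"
    have len: "length xs = n" using xs by (simp add: in_nlists_iff)
    have "xs @ ys \<in> nlists (n + m) D"
      using xs ys by (auto simp: in_nlists_iff)
    note sat[OF this]
    moreover have "(\<forall>(r, vs) \<in> \<Phi>1. map ((!) (xs @ ys)) vs \<in> snd r) \<longleftrightarrow>
        nonempty_compatible \<Delta> k (\<lambda>s. ys ! g s)"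
    proof -
      have "map ((!) (xs @ ys)) (map (\<lambda>i. n + g (map (\<lambda>t. t ! i) ts)) [0..<l]) =
          map (\<lambda>i. ys ! g (map (\<lambda>t. t ! i) ts)) [0..<l]" for ts l
        using len by (simp add: nth_append)
      moreover have "(\<forall>(r, vs) \<in> \<Phi>1. P r vs) \<longleftrightarrow>
          (\<forall>r \<in> \<Delta>. snd r \<noteq> {} \<longrightarrow> (\<forall>ts \<in> nlists k (snd r).
            P r (map (\<lambda>i. n + g (map (\<lambda>t. t ! i) ts)) [0..<fst r])))" for P
        unfolding \<Phi>1_def by blast
      ultimately show ?thesis
        unfolding nonempty_compatible_def by (simp only:)
    qed
    moreover have "(\<forall>(r, vs) \<in> \<Phi>2. map ((!) (xs @ ys)) vs \<in> snd r) \<longleftrightarrow>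
        (\<forall>i<n. xs ! i = ys ! g (map (\<lambda>t. t ! i) T))"
    proof -
      have "xs ! i \<in> D" if "i < n" for i
        using xs that by (rule nlistsE_nth_in)
      then have "map ((!) (xs @ ys)) [i, n + g (map (\<lambda>t. t ! i) T)] \<in> snd (Eq_rel D) \<longleftrightarrow>
          xs ! i = ys ! g (map (\<lambda>t. t ! i) T)" if "i < n" for i
        using len that by (auto simp: Eq_rel_def nth_append)
      moreover have "(\<forall>(r, vs) \<in> \<Phi>2. P r vs) \<longleftrightarrow>
          (\<forall>i<n. P (Eq_rel D) [i, n + g (map (\<lambda>t. t ! i) T)])" for P
        unfolding \<Phi>2_def by blast
      ultimately show ?thesis by simp
    qed
    moreover have "xs = map (\<lambda>i. ys ! g (map (\<lambda>t. t ! i) T)) [0..<n] \<longleftrightarrow>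
        (\<forall>i<n. xs ! i = ys ! g (map (\<lambda>t. t ! i) T))"
      using len by (auto simp: list_eq_iff_nth_eq)
    ultimately show "satisfies (xs @ ys) \<phi> \<longleftrightarrow>
        nonempty_compatible \<Delta> k (\<lambda>s. ys ! g s) \<and>
        xs = map (\<lambda>i. ys ! g (map (\<lambda>t. t ! i) T)) [0..<n]"
      by (simp only: ball_Un)
  qed
qed

text \<open>\<open>f\<close> is prescribed only on \<open>nlists k D\<close> since it will be a
  value table \<open>ys ! g s\<close>, which is meaningless for other \<open>s\<close>.\<close>

lemma nonempty_compatible_projection:
  assumes "\<Delta> \<subseteq> relations D" and "i < k" and f: "\<And>s. s \<in> nlists k D \<Longrightarrow> f s = s ! i"
  shows "nonempty_compatible \<Delta> k f"
  unfolding nonempty_compatible_def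
proof (intro ballI impI)
  fix r ts assume r: "r \<in> \<Delta>" and ts: "ts \<in> nlists k (snd r)"
  have sub: "snd r \<subseteq> nlists (fst r) D" using r assms(1) by (rule relation_subset_nlists)
  have len: "length ts = k" using ts by (simp add: in_nlists_iff)
  have mem: "ts ! i \<in> snd r"
    using ts \<open>i < k\<close> by (rule nlistsE_nth_in)
  have "map (\<lambda>j. f (map (\<lambda>t. t ! j) ts)) [0..<fst r] = map (\<lambda>j. ts ! i ! j) [0..<fst r]"
    using f column_in_nlists[OF ts sub] len \<open>i < k\<close> by auto
  also have "\<dots> = ts ! i"
    using mem sub by (auto simp: in_nlists_iff subset_iff intro!: nth_equalityI)
  finally show "map (\<lambda>j. f (map (\<lambda>t. t ! j) ts)) [0..<fst r] \<in> snd r" using mem by simp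
qed

lemma nonempty_compatible_constant:
  assumes "\<Delta> \<subseteq> relations D" and "c \<in> diagonal_values D \<Delta>" and f: "\<And>s. s \<in> nlists k D \<Longrightarrow> f s = c"
  shows "nonempty_compatible \<Delta> k f"
  unfolding nonempty_compatible_def
proof (intro ballI impI)
  fix r ts assume r: "r \<in> \<Delta>" and ne: "snd r \<noteq> {}" and ts: "ts \<in> nlists k (snd r)"
  have sub: "snd r \<subseteq> nlists (fst r) D" using r assms(1) by (rule relation_subset_nlists)
  have "map (\<lambda>j. f (map (\<lambda>t. t ! j) ts)) [0..<fst r] = map (\<lambda>j. c) [0..<fst r]"
    using f column_in_nlists[OF ts sub] by auto
  also have "\<dots> = replicate (fst r) c" by (simp add: map_replicate_const)
  finally show "map (\<lambda>j. f (map (\<lambda>t. t ! j) ts)) [0..<fst r] \<in> snd r"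
    using assms(2) r ne by (auto simp: diagonal_values_def)
qed

section \<open>Unique definability from the indicator conjunction\<close>

text \<open>By \<open>compatible_classification\<close> the satisfying tables are those of
  projections and of diagonal constants. Projections yield the listed tuples of \<open>R\<close>;
  constants yield the remaining ones, and \<open>diag\<close> keeps these inside
  \<open>R\<close>.\<close>

lemma upp_definable_if_diagonal_subset:
  assumes fin: "finite D" and \<Delta>: "\<Delta> \<subseteq> relations D"
    and pol: "\<And>p. p \<in> Pol D \<Delta> \<Longrightarrow> is_constant D p \<or> is_projection D p"
    and n: "n \<ge> 1" and R: "R \<subseteq> nlists n D"
    and diag: "\<And>c. c \<in> diagonal_values D \<Delta> \<Longrightarrow> replicate n c \<in> R"
  shows "\<exists>m \<phi>. upp_definition D \<Delta> n m \<phi> R"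
proof -
  let ?U = "diagonal_values D \<Delta>"
  have "finite R" using R finite_nlists[OF fin] finite_subset by blast
  then obtain T where T: "set T = R - replicate n ` ?U" and dist: "distinct T"
    using finite_distinct_list[of "R - replicate n ` ?U"] by blast
  define k where "k = length T"
  have Tk: "T \<in> nlists k (nlists n D)" using T R by (intro nlistsI) (auto simp: k_def)
  obtain m \<phi> g where over: "conjunction_over D \<Delta> (n + m) \<phi>"
    and g: "bij_betw g (nlists k D) {..<m}"
    and sat: "\<And>xs ys. xs \<in> nlists n D \<Longrightarrow> ys \<in> nlists m D \<Longrightarrow>
      satisfies (xs @ ys) \<phi> \<longleftrightarrow>
        nonempty_compatible \<Delta> k (\<lambda>s. ys ! g s) \<and>
        xs = map (\<lambda>i. ys ! g (map (\<lambda>t. t ! i) T)) [0..<n]"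
    using indicator_conjunction[OF fin \<Delta> Tk] by metis
  have gm: "g s < m" if "s \<in> nlists k D" for s
    using g that by (auto simp: bij_betw_def)
  have colT: "map (\<lambda>t. t ! i) T \<in> nlists k D" if "i < n" for i
    using column_in_nlists[OF Tk subset_refl that] .
  have Tn: "length (T ! i) = n" if "i < k" for i
    using that Tk nth_mem[of i T] by (auto simp: in_nlists_iff k_def subset_iff simp del: nth_mem)
  \<comment> \<open>Since \<open>g\<close> is injective on the arguments, any function into
    \<open>D\<close> can be written into a table by pulling indices back along
    \<open>g\<close>.\<close>
  have tab: "\<exists>ys \<in> nlists m D. \<forall>s \<in> nlists k D. ys ! g s = f s"
    if f: "f \<in> nlists k D \<rightarrow> D" for f
  proof
    let ?h = "inv_into (nlists k D) g"
    let ?ys = "map (\<lambda>j. f (?h j)) [0..<m]"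
    have "?h j \<in> nlists k D" if "j < m" for j
      using g that by (metis bij_betw_def inv_into_into lessThan_iff)
    then show "?ys \<in> nlists m D" using f by (auto simp: in_nlists_iff[of _ m])
    show "\<forall>s \<in> nlists k D. ?ys ! g s = f s"
      using gm g by (auto simp: bij_betw_def)
  qed
  have proj: "map (\<lambda>j. f (map (\<lambda>t. t ! j) T)) [0..<n] = T ! i"
    if "i < k" "\<forall>s \<in> nlists k D. f s = s ! i" for f i
    using that colT Tn by (intro nth_equalityI) (auto simp: k_def)
  have const: "map (\<lambda>j. f (map (\<lambda>t. t ! j) T)) [0..<n] = replicate n c"
    if "\<forall>s \<in> nlists k D. f s = c" for f c
    using that colT by (intro nth_equalityI) auto
  have cases: "(\<exists>c \<in> ?U. (\<forall>s \<in> nlists k D. ys ! g s = c) \<and> xs = replicate n c) \<or>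
      (\<exists>i<k. (\<forall>s \<in> nlists k D. ys ! g s = s ! i) \<and> xs = T ! i)"
    if xs: "xs \<in> nlists n D" and ys: "ys \<in> nlists m D" and s: "satisfies (xs @ ys) \<phi>" for xs ys
  proof -
    have comp: "nonempty_compatible \<Delta> k (\<lambda>s. ys ! g s)"
      and xs': "xs = map (\<lambda>i. ys ! g (map (\<lambda>t. t ! i) T)) [0..<n]"
      using sat[OF xs ys] s by auto
    have "(\<lambda>s. ys ! g s) \<in> nlists k D \<rightarrow> D"
    proof
      fix s assume "s \<in> nlists k D"
      then show "ys ! g s \<in> D"
        using gm ys by (auto intro: nlistsE_nth_in)
    qed
    from compatible_classification[OF \<Delta> pol this comp]
    show ?thesis
      using proj[of _ "\<lambda>s. ys ! g s"] const[of "\<lambda>s. ys ! g s"] xs' by metis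
  qed
  have "xs \<in> R \<longleftrightarrow> xs \<in> nlists n D \<and> (\<exists>ys \<in> nlists m D. satisfies (xs @ ys) \<phi>)" for xs
  proof
    assume xs: "xs \<in> R"
    then have xsn: "xs \<in> nlists n D" using R by blast
    show "xs \<in> nlists n D \<and> (\<exists>ys \<in> nlists m D. satisfies (xs @ ys) \<phi>)"
    proof (cases "xs \<in> replicate n ` ?U")
      case True
      then obtain c where c: "c \<in> ?U" "xs = replicate n c" by blast
      have "c \<in> D" using c by (simp add: diagonal_values_def)
      then obtain ys where ys: "ys \<in> nlists m D" "\<forall>s \<in> nlists k D. ys ! g s = c"
        using tab[of "\<lambda>_. c"] by auto
      have "satisfies (xs @ ys) \<phi>"
        using sat[OF xsn ys(1)] nonempty_compatible_constant[OF \<Delta> c(1), of k "\<lambda>s. ys ! g s"]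
          const[of "\<lambda>s. ys ! g s" c] ys c by simp
      then show ?thesis using xsn ys by blast
    next
      case False
      then obtain i where i: "i < k" "xs = T ! i"
        using xs T by (metis DiffI in_set_conv_nth k_def)
      have "(\<lambda>s. s ! i) \<in> nlists k D \<rightarrow> D"
        using i by (auto intro: nlistsE_nth_in)
      then obtain ys where ys: "ys \<in> nlists m D" "\<forall>s \<in> nlists k D. ys ! g s = s ! i"
        using tab by blast
      have "satisfies (xs @ ys) \<phi>"
        using sat[OF xsn ys(1)] nonempty_compatible_projection[OF \<Delta> i(1), of "\<lambda>s. ys ! g s"]
          proj[of i "\<lambda>s. ys ! g s"] ys i by simp
      then show ?thesis using xsn ys by blast
    qed
  next
    assume "xs \<in> nlists n D \<and> (\<exists>ys \<in> nlists m D. satisfies (xs @ ys) \<phi>)"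
    then show "xs \<in> R" using cases diag T by (metis DiffE k_def nth_mem)
  qed
  then have pp: "pp_definition D \<Delta> n m \<phi> R"
    using over by (auto simp: pp_definition_def)
  have uniq: "ys = zs"
    if xs: "xs \<in> nlists n D" and ys: "ys \<in> nlists m D" "satisfies (xs @ ys) \<phi>"
      and zs: "zs \<in> nlists m D" "satisfies (xs @ zs) \<phi>" for xs ys zs
  proof -
    \<comment> \<open>Two tables with the same \<open>xs\<close> must coincide: \<open>new\<close>
      separates projections from constants, \<open>inj\<close> separates projections, and
      \<open>repl\<close>, where \<open>n\<close> must be positive, separates constants. As
      \<open>g\<close> is onto the indices, equal functions give equal lists.\<close>
    have new: "T ! i \<noteq> replicate n c" if "i < k" "c \<in> ?U" for i c
      using that T nth_mem[of i T] by (auto simp: k_def simp del: nth_mem)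
    have inj: "i = j" if "i < k" "j < k" "T ! i = T ! j" for i j
      using that dist by (simp add: k_def nth_eq_iff_index_eq)
    have repl: "c = d" if "replicate n c = replicate n d" for c d :: 'a
      using that n by simp
    have "\<forall>s \<in> nlists k D. ys ! g s = zs ! g s"
      using cases[OF xs ys] cases[OF xs zs] new inj repl by metis
    then have "ys ! j = zs ! j" if "j < m" for j
      using g that by (metis bij_betw_def imageE lessThan_iff)
    then show ?thesis using ys(1) zs(1) by (intro nth_equalityI) (auto simp: in_nlists_iff)
  qed
  have "\<exists>h \<in> nlists n D \<rightarrow> D. \<forall>xs \<in> nlists n D. \<forall>ys \<in> nlists m D.
        satisfies (xs @ ys) \<phi> \<longrightarrow> ys ! j = h xs" if j: "j < m" for j
  proof
    let ?P = "\<lambda>xs ys. ys \<in> nlists m D \<and> satisfies (xs @ ys) \<phi>"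
    \<comment> \<open>The default \<open>hd xs\<close> lies in \<open>D\<close> because
      \<open>n\<close> is positive. Choosing a fixed element of \<open>D\<close> instead would fail
      for empty \<open>D\<close>.\<close>
    let ?h = "\<lambda>xs. if \<exists>ys. ?P xs ys then (THE ys. ?P xs ys) ! j else hd xs"
    have the: "(THE ys. ?P xs ys) = ys" if "xs \<in> nlists n D" "?P xs ys" for xs ys
      using that uniq by (intro the_equality) auto
    show "\<forall>xs \<in> nlists n D. \<forall>ys \<in> nlists m D. satisfies (xs @ ys) \<phi> \<longrightarrow> ys ! j = ?h xs"
      using the by auto
    show "?h \<in> nlists n D \<rightarrow> D"
    proof
      fix xs assume xs: "xs \<in> nlists n D"
      have "ys ! j \<in> D" if "ys \<in> nlists m D" for ys
        using that j by (rule nlistsE_nth_in)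
      moreover have "hd xs \<in> D" using xs n by (cases xs) (auto simp: in_nlists_iff)
      ultimately show "?h xs \<in> D" using the[OF xs] by auto
    qed
  qed
  then show ?thesis using pp unfolding upp_definition_def by blast
qed

section \<open>Passage to an arbitrary base\<close>

theorem theorem13:
  fixes D :: "'a set" and \<Gamma> :: "'a relation set"
  assumes "finite D"
    and "\<Gamma> \<subseteq> relations D"
    and "\<And>p. p \<in> Pol D \<Gamma> \<Longrightarrow> is_constant D p \<or> is_projection D p"
  shows "uniquely_covered D (pp_closure D \<Gamma>)"
  unfolding uniquely_covered_def
proof (intro allI impI)
  fix \<Delta> assume "is_base D \<Delta> (pp_closure D \<Gamma>)"
  then have \<Delta>: "\<Delta> \<subseteq> relations D" and eq: "pp_closure D \<Delta> = pp_closure D \<Gamma>"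
    by (auto simp: is_base_def)
  have "Pol D \<Delta> \<subseteq> Pol D \<Gamma>"
    using Pol_subset_if_subset_pp_closure subset_pp_closure[OF assms(2)] eq by blast
  then have pol: "is_constant D p \<or> is_projection D p" if "p \<in> Pol D \<Delta>" for p
    using that assms(3) by blast
  have "(n, R) \<in> upp_closure D \<Delta>" if mem: "(n, R) \<in> pp_closure D \<Delta>" for n R
  proof -
    obtain m \<phi> where n: "n \<ge> 1" and pp: "pp_definition D \<Delta> n m \<phi> R"
      using mem by (auto simp: pp_closure_def)
    have "\<exists>m \<phi>. upp_definition D \<Delta> n m \<phi> R"
    \<comment> \<open>The empty relation is treated apart because the indicator conjunction always
      admits the diagonal constants, whose tuples would not be in \<open>R\<close>.\<close>
    proof (cases "R = {}")
      case True
      then show ?thesis using upp_definition_if_empty pp n by blast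
    next
      case False
      have "R \<subseteq> nlists n D" using pp by (auto simp: pp_definition_def)
      then show ?thesis
        using upp_definable_if_diagonal_subset[OF assms(1) \<Delta> pol n]
          replicate_diagonal_in_pp_definable[OF \<Delta> pp False] by blast
    qed
    then show ?thesis using n by (auto simp: upp_closure_def)
  qed
  then have "pp_closure D \<Delta> \<subseteq> upp_closure D \<Delta>" by auto
  then show "upp_closure D \<Delta> = pp_closure D \<Gamma>"
    using upp_closure_subset_pp_closure eq by blast
qed

end
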